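(* Let $(R,f,g)$ be a commutative Krasner $(m,n)$-hyperring with scalar identity $1$, let $S$ be an $n$-ary multiplicative subset of $R$, and let $I$ be a hyperideal of $R$ with $I\cap S=\varnothing$. Then $I$ is an $n$-ary $S$-prime hyperideal of $R$ if and only if there exists $s\in S$ such that $(I:s)=\{r\in R \mid g(r,s,1^{(n-2)})\in I\}$ is an $n$-ary prime hyperideal of $R$.
   Context: Notation: $x_i^j$ denotes the sequence $x_i,\dots,x_j$ (empty if $j<i$); $x^{(k)}$ denotes $x$ repeated $k$ times; operations are extended to subsets elementwise (taking unions); $m,n\ge 2$ are integers. An $m$-ary hyperoperation on $R$ is a map $f$ from $R^m$ to the nonempty subsets of $R$. $(R,f)$ is a (commutative) canonical $m$-ary hypergroup if $f$ is invariant under permuting its arguments; $f$ is associative, i.e. $f(x_1^{i-1},f(x_i^{m+i-1}),x_{m+i}^{2m-1})$ does not depend on $i$; for all $a_1^{i-1},a_{i+1}^m,b\in R$ there is $x\in R$ with $b\in f(a_1^{i-1},x,a_{i+1}^m)$; there is a unique $0\in R$ with $f(x,0^{(m-1)})=\{x\}$ for all $x$; each $x$ has a unique $-x$ with $0\in f(x,-x,0^{(m-2)})$; and $x\in f(x_1^m)$ implies $x_i\in f(x,-x_1,\dots,-x_{i-1},-x_{i+1},\dots,-x_m)$ for all $i$. A commutative Krasner $(m,n)$-hyperring $(R,f,g)$ is such an $(R,f)$ together with an associative, permutation-invariant $n$-ary operation $g:R^n\to R$ that is distributive over $f$ in each argument, i.e. $g(a_1^{i-1},f(x_1^m),a_{i+1}^n)=f(g(a_1^{i-1},x_1,a_{i+1}^n),\dots,g(a_1^{i-1},x_m,a_{i+1}^n))$,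 and satisfies $g(0,x_2^n)=0$. A scalar identity is an element $1$ with $g(x,1^{(n-1)})=x$ for all $x$. A hyperideal of $R$ is a nonempty $I\subseteq R$ such that $(I,f)$ is an $m$-ary subhypergroup of $(R,f)$ (i.e. $f(x_1^m)\subseteq I$ for $x_1^m\in I$, and $b\in f(b_1^{i-1},x,b_{i+1}^m)$ has a solution $x\in I$ whenever all $b$'s lie in $I$) and $g(x_1^{i-1},I,x_{i+1}^n)\subseteq I$ for all $x_j\in R$ and all $i$. An $n$-ary prime hyperideal is a hyperideal $P\ne R$ such that for hyperideals $U_1,\dots,U_n$ of $R$, $g(U_1^n)\subseteq P$ implies $U_i\subseteq P$ for some $i$; equivalently, for all $x_1^n\in R$, $g(x_1^n)\in P$ implies $x_i\in P$ for some $i$. An $n$-ary multiplicative subset is a nonempty $S\subseteq R$ with $g(s_1^n)\in S$ for all $s_1^n\in S$. A hyperideal $I$ with $I\cap S=\varnothing$ is an $n$-ary $S$-prime hyperideal if there exists $s\in S$ such that for all $x_1^n\in R$ with $g(x_1^n)\in I$ one has $g(s,x_i,1^{(n-2)})\in I$ for some $1\le i\le n$. *)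

theory Defs
  imports Main "HOL-Library.NList" "HOL-Library.Multiset"
begin

text \<open>
  A \<open>k\<close>-tuple over \<open>A\<close> is a list in \<^term>\<open>nlists k A\<close>. An \<open>m\<close>-ary hyperoperation is a map from
  lists to sets and an \<open>n\<close>-ary operation a map from lists to elements; only their values on
  \<^term>\<open>nlists m R\<close> and \<^term>\<open>nlists n R\<close> matter. List positions start at 0.
\<close>

definition insert_at :: "nat \<Rightarrow> 'a \<Rightarrow> 'a list \<Rightarrow> 'a list" where
  "insert_at i x as = take i as @ x # drop i as"

definition remove_at :: "nat \<Rightarrow> 'a list \<Rightarrow> 'a list" where
  "remove_at i xs = take i xs @ drop (Suc i) xs"

definition is_hyper_zero :: "nat \<Rightarrow> 'a set \<Rightarrow> ('a list \<Rightarrow> 'a set) \<Rightarrow> 'a \<Rightarrow> bool" where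
  "is_hyper_zero m R f z \<longleftrightarrow> z \<in> R \<and> (\<forall>x\<in>R. f (x # replicate (m - 1) z) = {x})"

definition hyper_zero :: "nat \<Rightarrow> 'a set \<Rightarrow> ('a list \<Rightarrow> 'a set) \<Rightarrow> 'a" where
  "hyper_zero m R f = (THE z. is_hyper_zero m R f z)"

definition is_hyper_neg :: "nat \<Rightarrow> 'a set \<Rightarrow> ('a list \<Rightarrow> 'a set) \<Rightarrow> 'a \<Rightarrow> 'a \<Rightarrow> bool" where
  "is_hyper_neg m R f x y \<longleftrightarrow>
     y \<in> R \<and> hyper_zero m R f \<in> f (x # y # replicate (m - 2) (hyper_zero m R f))"

definition hyper_neg :: "nat \<Rightarrow> 'a set \<Rightarrow> ('a list \<Rightarrow> 'a set) \<Rightarrow> 'a \<Rightarrow> 'a" where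
  "hyper_neg m R f x = (THE y. is_hyper_neg m R f x y)"

text \<open>
  In \<open>f_assoc\<close> and \<open>distrib\<close> below, the extension of an operation to a set in one argument is
  written out as the union (or image) over the elements of that set.
\<close>

locale canonical_hypergroup =
  fixes m :: nat and R :: "'a set" and f :: "'a list \<Rightarrow> 'a set"
  assumes m_ge_2: "m \<ge> 2"
    and f_closed: "\<And>xs. xs \<in> nlists m R \<Longrightarrow> f xs \<subseteq> R"
    and f_nonempty: "\<And>xs. xs \<in> nlists m R \<Longrightarrow> f xs \<noteq> {}"
    and f_perm: "\<And>xs ys. xs \<in> nlists m R \<Longrightarrow> mset xs = mset ys \<Longrightarrow> f xs = f ys"
    and f_assoc: "\<And>xs i j. xs \<in> nlists (2 * m - 1) R \<Longrightarrow> i < m \<Longrightarrow> j < m \<Longrightarrow>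
      (\<Union>y\<in>f (take m (drop i xs)). f (take i xs @ y # drop (i + m) xs)) =
      (\<Union>y\<in>f (take m (drop j xs)). f (take j xs @ y # drop (j + m) xs))"
    and f_solvable: "\<And>as b i. as \<in> nlists (m - 1) R \<Longrightarrow> b \<in> R \<Longrightarrow> i < m \<Longrightarrow>
      \<exists>x\<in>R. b \<in> f (insert_at i x as)"
    and zero_ex1: "\<exists>!z. is_hyper_zero m R f z"
    and neg_ex1: "\<And>x. x \<in> R \<Longrightarrow> \<exists>!y. is_hyper_neg m R f x y"
    and reversible: "\<And>x xs i. xs \<in> nlists m R \<Longrightarrow> x \<in> f xs \<Longrightarrow> i < m \<Longrightarrow>
      xs ! i \<in> f (x # map (hyper_neg m R f) (remove_at i xs))"

locale comm_krasner_hyperring = canonical_hypergroup m R f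
  for m n :: nat and R :: "'a set" and f :: "'a list \<Rightarrow> 'a set" and g :: "'a list \<Rightarrow> 'a" +
  assumes n_ge_2: "n \<ge> 2"
    and g_closed: "\<And>xs. xs \<in> nlists n R \<Longrightarrow> g xs \<in> R"
    and g_perm: "\<And>xs ys. xs \<in> nlists n R \<Longrightarrow> mset xs = mset ys \<Longrightarrow> g xs = g ys"
    and g_assoc: "\<And>xs i j. xs \<in> nlists (2 * n - 1) R \<Longrightarrow> i < n \<Longrightarrow> j < n \<Longrightarrow>
      g (take i xs @ g (take n (drop i xs)) # drop (i + n) xs) =
      g (take j xs @ g (take n (drop j xs)) # drop (j + n) xs)"
    and distrib: "\<And>as xs i. as \<in> nlists (n - 1) R \<Longrightarrow> xs \<in> nlists m R \<Longrightarrow> i < n \<Longrightarrow>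
      (\<lambda>x. g (insert_at i x as)) ` f xs = f (map (\<lambda>x. g (insert_at i x as)) xs)"
    and g_zero: "\<And>as. as \<in> nlists (n - 1) R \<Longrightarrow>
      g (hyper_zero m R f # as) = hyper_zero m R f"

definition scalar_identity :: "nat \<Rightarrow> 'a set \<Rightarrow> ('a list \<Rightarrow> 'a) \<Rightarrow> 'a \<Rightarrow> bool" where
  "scalar_identity n R g e \<longleftrightarrow> e \<in> R \<and> (\<forall>x\<in>R. g (x # replicate (n - 1) e) = x)"

definition hyperideal ::
  "nat \<Rightarrow> nat \<Rightarrow> 'a set \<Rightarrow> ('a list \<Rightarrow> 'a set) \<Rightarrow> ('a list \<Rightarrow> 'a) \<Rightarrow> 'a set \<Rightarrow> bool" where
  "hyperideal m n R f g I \<longleftrightarrow>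
     I \<subseteq> R \<and> I \<noteq> {} \<and>
     (\<forall>xs\<in>nlists m I. f xs \<subseteq> I) \<and>
     (\<forall>bs\<in>nlists (m - 1) I. \<forall>b\<in>I. \<forall>i<m. \<exists>x\<in>I. b \<in> f (insert_at i x bs)) \<and>
     (\<forall>as\<in>nlists (n - 1) R. \<forall>a\<in>I. \<forall>i<n. g (insert_at i a as) \<in> I)"

text \<open>
  For a list \<open>Us\<close> of sets, \<^term>\<open>g ` listset Us\<close> is the elementwise extension
  of \<open>g\<close> to \<open>Us\<close>.
\<close>

definition prime_hyperideal ::
  "nat \<Rightarrow> nat \<Rightarrow> 'a set \<Rightarrow> ('a list \<Rightarrow> 'a set) \<Rightarrow> ('a list \<Rightarrow> 'a) \<Rightarrow> 'a set \<Rightarrow> bool" where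
  "prime_hyperideal m n R f g P \<longleftrightarrow>
     hyperideal m n R f g P \<and> P \<noteq> R \<and>
     (\<forall>Us\<in>nlists n {U. hyperideal m n R f g U}. g ` listset Us \<subseteq> P \<longrightarrow> (\<exists>i<n. Us ! i \<subseteq> P))"

definition multiplicative_subset :: "nat \<Rightarrow> 'a set \<Rightarrow> ('a list \<Rightarrow> 'a) \<Rightarrow> 'a set \<Rightarrow> bool" where
  "multiplicative_subset n R g S \<longleftrightarrow> S \<subseteq> R \<and> S \<noteq> {} \<and> (\<forall>xs\<in>nlists n S. g xs \<in> S)"

definition S_prime_hyperideal ::
  "nat \<Rightarrow> nat \<Rightarrow> 'a set \<Rightarrow> ('a list \<Rightarrow> 'a set) \<Rightarrow> ('a list \<Rightarrow> 'a) \<Rightarrow> 'a \<Rightarrow> 'a set \<Rightarrow> 'a set \<Rightarrow> bool" where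
  "S_prime_hyperideal m n R f g e S I \<longleftrightarrow>
     hyperideal m n R f g I \<and> I \<inter> S = {} \<and>
     (\<exists>s\<in>S. \<forall>xs\<in>nlists n R. g xs \<in> I \<longrightarrow> (\<exists>i<n. g (s # xs ! i # replicate (n - 2) e) \<in> I))"

definition colon :: "nat \<Rightarrow> 'a set \<Rightarrow> ('a list \<Rightarrow> 'a) \<Rightarrow> 'a \<Rightarrow> 'a set \<Rightarrow> 'a \<Rightarrow> 'a set" where
  "colon n R g e I s = {r \<in> R. g (r # s # replicate (n - 2) e) \<in> I}"

end

theory Submission
  imports Defs
begin

text \<open>
  With a scalar identity \<open>e\<close>, the operation \<open>g\<close> is the iterated product of the commutative monoid
  \<open>a \<cdot> b = g(a, b, e, \<dots>, e)\<close> on \<open>R\<close>.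

  If \<open>I\<close> is \<open>S\<close>-prime with witness \<open>s\<close> and \<open>s \<cdot> x\<^sub>1 \<cdots> x\<^sub>n \<in> I\<close>, then applying
  \<open>S\<close>-primeness to \<open>g(s \<cdot> x\<^sub>1, x\<^sub>2, \<dots>, x\<^sub>n)\<close> gives \<open>s \<cdot> x\<^sub>i \<in> I\<close> for some \<open>i \<ge> 2\<close>, or
  \<open>s \<cdot> s \<cdot> x\<^sub>1 \<in> I\<close>. In the latter case \<open>S\<close>-primeness applied to \<open>g(s \<cdot> s, x\<^sub>1, e, \<dots>, e)\<close> gives
  \<open>s \<cdot> x\<^sub>1 \<in> I\<close>, since \<open>s\<^sup>3 \<in> I\<close> would put \<open>s\<^bsup>2n-1\<^esup> \<in> S\<close> into \<open>I\<close>. Hence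
  \<open>(I : s)\<close> is prime elementwise, with the same \<open>s\<close>.

  Conversely, if \<open>(I : s)\<close> is prime and \<open>g(x\<^sub>1, \<dots>, x\<^sub>n) \<in> I\<close>, then the product of the
  principal hyperideals \<open>R \<cdot> x\<^sub>i\<close> lies in \<open>I \<subseteq> (I : s)\<close>, so some \<open>x\<^sub>i\<close> lies in \<open>(I : s)\<close>.
\<close>

text \<open>As conditional rewrite rules for \<open>length\<close> and \<open>set\<close>, these loop with \<open>nlists_iff\<close>.\<close>

declare nlistsE_length [simp del] nlistsE_set [simp del]

section \<open>Tuples as lists\<close>

lemma nlists_iff: "xs \<in> nlists k A \<longleftrightarrow> length xs = k \<and> set xs \<subseteq> A"
  by (simp add: nlists_def)

lemma mset_insert_at: "mset (insert_at i x as) = mset (x # as)"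
proof -
  have "mset (take i as @ x # drop i as) = mset (x # take i as @ drop i as)"
    by (simp del: append_take_drop_id)
  then show ?thesis
    by (simp add: insert_at_def)
qed

lemma length_insert_at: "length (insert_at i x as) = Suc (length as)"
  by (simp add: insert_at_def)

lemma set_insert_at: "set (insert_at i x as) = insert x (set as)"
  by (metis list.simps(15) mset_eq_setD mset_insert_at)

lemma nth_insert_at: "i \<le> length as \<Longrightarrow> insert_at i x as ! i = x"
  by (simp add: insert_at_def nth_append)

lemma remove_at_insert_at: "i \<le> length as \<Longrightarrow> remove_at i (insert_at i x as) = as"
  by (simp add: insert_at_def remove_at_def)

text \<open>Replaces the elementwise product of sets by a positionwise relation, to which list
  induction and indexing apply.\<close>

lemma mem_listset_iff: "xs \<in> listset As \<longleftrightarrow> list_all2 (\<in>) xs As"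
proof (induction As arbitrary: xs)
  case (Cons A As)
  then show ?case
    by (cases xs) (auto simp: set_Cons_def)
qed simp

section \<open>Zero and negatives\<close>

context canonical_hypergroup
begin

abbreviation zero where "zero \<equiv> hyper_zero m R f"
abbreviation neg where "neg \<equiv> hyper_neg m R f"

lemma is_hyper_zero_zero: "is_hyper_zero m R f zero"
  unfolding hyper_zero_def by (rule theI'[OF zero_ex1])

lemma is_hyper_neg_neg: "x \<in> R \<Longrightarrow> is_hyper_neg m R f x (neg x)"
  unfolding hyper_neg_def by (rule theI'[OF neg_ex1])

lemma zero_in: "zero \<in> R"
  using is_hyper_zero_zero by (simp add: is_hyper_zero_def)

lemma neg_in: "x \<in> R \<Longrightarrow> neg x \<in> R"
  using is_hyper_neg_neg by (simp add: is_hyper_neg_def)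

lemma zero_in_f_neg: "x \<in> R \<Longrightarrow> zero \<in> f (x # neg x # replicate (m - 2) zero)"
  using is_hyper_neg_neg by (simp add: is_hyper_neg_def)

lemma neg_unique:
  assumes "x \<in> R" "y \<in> R" "zero \<in> f (x # y # replicate (m - 2) zero)"
  shows "y = neg x"
proof -
  have "is_hyper_neg m R f x y"
    using assms(2,3) by (simp add: is_hyper_neg_def)
  then show ?thesis
    using neg_ex1[OF assms(1)] is_hyper_neg_neg[OF assms(1)] by blast
qed

end

section \<open>The commutative monoid underlying \<open>g\<close>\<close>

locale unital_krasner_hyperring = comm_krasner_hyperring m n R f g
  for m n :: nat and R :: "'a set" and f :: "'a list \<Rightarrow> 'a set" and g :: "'a list \<Rightarrow> 'a" +
  fixes e :: 'a
  assumes scalar_id: "scalar_identity n R g e"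
begin

definition mul :: "'a \<Rightarrow> 'a \<Rightarrow> 'a" (infixl "\<cdot>" 70) where
  "a \<cdot> b = g (a # b # replicate (n - 2) e)"

abbreviation lprod :: "'a list \<Rightarrow> 'a" where
  "lprod xs \<equiv> foldr (\<cdot>) xs e"

lemma e_in: "e \<in> R"
  using scalar_id by (simp add: scalar_identity_def)

lemma g_scalar: "x \<in> R \<Longrightarrow> g (x # replicate (n - 1) e) = x"
  using scalar_id by (simp add: scalar_identity_def)

lemma replicate_n_minus_1: "replicate (n - 1) x = x # replicate (n - 2) x"
proof -
  have "n - 1 = Suc (n - 2)"
    using n_ge_2 by simp
  then show ?thesis
    by simp
qed

lemma mul_closed: "a \<in> R \<Longrightarrow> b \<in> R \<Longrightarrow> a \<cdot> b \<in> R"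
  unfolding mul_def using n_ge_2 e_in by (intro g_closed) (auto simp: nlists_iff)

lemma mul_comm: "a \<in> R \<Longrightarrow> b \<in> R \<Longrightarrow> a \<cdot> b = b \<cdot> a"
  unfolding mul_def using n_ge_2 e_in by (intro g_perm) (auto simp: nlists_iff)

lemma mul_e: "a \<in> R \<Longrightarrow> a \<cdot> e = a"
  using g_scalar[of a] unfolding mul_def replicate_n_minus_1 .

lemma e_mul: "a \<in> R \<Longrightarrow> e \<cdot> a = a"
  using mul_comm[of a e] e_in by (simp add: mul_e)

lemma mul_assoc:
  assumes "a \<in> R" "b \<in> R" "c \<in> R"
  shows "a \<cdot> b \<cdot> c = a \<cdot> (b \<cdot> c)"
proof -
  obtain k where k: "n = Suc (Suc k)"
    using n_ge_2 by (metis add_2_eq_Suc le_Suc_ex)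
  have mul_k: "x \<cdot> y = g (x # y # replicate k e)" for x y
    unfolding mul_def by (simp add: k)
  \<comment> \<open>Bracketing this (2n-1)-tuple at position 0 gives the left side, and at position
    1 the right side up to moving \<open>c\<close> next to \<open>b\<close>.\<close>
  let ?L = "a # b # replicate k e @ c # replicate k e"
  have "?L \<in> nlists (2 * n - 1) R"
    using assms k e_in by (auto simp: nlists_iff)
  from g_assoc[OF this, of 0 1]
  have "g (g (a # b # replicate k e) # c # replicate k e) =
      g (a # g (b # replicate k e @ [c]) # replicate k e)"
    by (simp add: k)
  moreover have "g (b # replicate k e @ [c]) = g (b # c # replicate k e)"
    using assms e_in by (intro g_perm) (auto simp: k nlists_iff)
  ultimately show ?thesis
    by (simp add: mul_k)
qed

lemma mul_left_comm: "a \<in> R \<Longrightarrow> b \<in> R \<Longrightarrow> c \<in> R \<Longrightarrow> a \<cdot> (b \<cdot> c) = b \<cdot> (a \<cdot> c)"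
  using mul_assoc[of a b c] mul_assoc[of b a c] mul_comm[of a b] by simp

lemmas mul_ac = mul_assoc mul_comm mul_left_comm

lemma lprod_closed: "set xs \<subseteq> R \<Longrightarrow> lprod xs \<in> R"
  by (induction xs) (auto simp: e_in mul_closed)

text \<open>Bracketing \<open>x, ys, e, ..., e\<close> at position 0 returns
  \<open>g (x # ys)\<close> by the identity law; bracketing at position 1 splits off
  \<open>x\<close>. The spare \<open>e\<close> keeps the arity at \<open>n\<close>.\<close>

lemma g_Cons:
  assumes "x # ys \<in> nlists n R"
  shows "g (x # ys) = x \<cdot> g (ys @ [e])"
proof -
  obtain k where k: "n = Suc (Suc k)"
    using n_ge_2 by (metis add_2_eq_Suc le_Suc_ex)
  have len: "length ys = Suc k"
    using assms by (simp add: nlists_iff k)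
  let ?L = "x # ys @ e # replicate k e"
  have "?L \<in> nlists (2 * n - 1) R"
    using assms k len e_in by (auto simp: nlists_iff)
  from g_assoc[OF this, of 0 1]
  have "g (g (x # ys) # e # replicate k e) = g (x # g (ys @ [e]) # replicate k e)"
    using len by (simp add: k)
  moreover have "g (g (x # ys) # e # replicate k e) = g (x # ys)"
    using g_scalar[OF g_closed[OF assms]] by (simp add: k)
  ultimately show ?thesis
    unfolding mul_def by (simp add: k)
qed

text \<open>The arity of \<open>g\<close> is fixed, so the induction runs over shorter lists padded
  with \<open>e\<close>.\<close>

lemma g_pad_eq_lprod:
  assumes "length ys \<le> n" "set ys \<subseteq> R"
  shows "g (ys @ replicate (n - length ys) e) = lprod ys"
  using assms
proof (induction ys)
  case Nil
  have "replicate n e = e # replicate (n - 1) e"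
    using n_ge_2 by (cases n) auto
  then show ?case
    using g_scalar[OF e_in] by simp
next
  case (Cons y ys)
  let ?r = "replicate (n - Suc (length ys)) e"
  have "g (y # ys @ ?r) = y \<cdot> g ((ys @ ?r) @ [e])"
    using Cons.prems e_in by (intro g_Cons) (auto simp: nlists_iff)
  \<comment> \<open>The \<open>e\<close> appended by \<open>g_Cons\<close> takes the place of the
    removed \<open>y\<close> and restores the padding for \<open>ys\<close>.\<close>
  also have "(ys @ ?r) @ [e] = ys @ replicate (Suc (n - Suc (length ys))) e"
    by (simp add: replicate_append_same)
  also have "Suc (n - Suc (length ys)) = n - length ys"
    using Cons.prems by simp
  finally show ?case
    using Cons by simp
qed

lemma g_eq_lprod: "xs \<in> nlists n R \<Longrightarrow> g xs = lprod xs"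
  using g_pad_eq_lprod[of xs] by (simp add: nlists_iff)

section \<open>Compatibility of the product with \<open>f\<close>, zero and negatives\<close>

lemma f_distrib:
  assumes "xs \<in> nlists m R" "r \<in> R"
  shows "(\<lambda>x. x \<cdot> r) ` f xs = f (map (\<lambda>x. x \<cdot> r) xs)"
proof -
  have "r # replicate (n - 2) e \<in> nlists (n - 1) R"
    using assms n_ge_2 e_in by (auto simp: nlists_iff)
  from distrib[OF this assms(1), of 0] show ?thesis
    using n_ge_2 by (simp add: insert_at_def mul_def)
qed

lemma zero_mul: "r \<in> R \<Longrightarrow> zero \<cdot> r = zero"
  unfolding mul_def using n_ge_2 e_in by (intro g_zero) (auto simp: nlists_iff)

text \<open>Multiplying \<open>zero \<in> f (a # neg a # ...)\<close> by \<open>r\<close> exhibits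
  \<open>neg a \<cdot> r\<close> as a negative of \<open>a \<cdot> r\<close>, and negatives are
  unique.\<close>

lemma neg_mul:
  assumes "a \<in> R" "r \<in> R"
  shows "neg a \<cdot> r = neg (a \<cdot> r)"
proof (rule neg_unique)
  let ?xs = "a # neg a # replicate (m - 2) zero"
  have "?xs \<in> nlists m R"
    using assms m_ge_2 by (auto simp: nlists_iff neg_in zero_in)
  note distr = f_distrib[OF this assms(2)]
  have "zero \<cdot> r \<in> f (map (\<lambda>x. x \<cdot> r) ?xs)"
    unfolding distr[symmetric] by (intro imageI zero_in_f_neg assms)
  then show "zero \<in> f (a \<cdot> r # neg a \<cdot> r # replicate (m - 2) zero)"
    using assms by (simp add: zero_mul map_replicate)
qed (simp_all add: assms neg_in mul_closed)

section \<open>Hyperideals\<close>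

text \<open>Closure under negatives replaces solvability: a solution exists in \<open>R\<close>, and
  reversibility places it in a sum of elements of \<open>J\<close>. Absorption by \<open>g\<close>
  reduces to the binary product, since the other arguments multiply to a single element of
  \<open>R\<close>.\<close>

lemma hyperidealI:
  assumes "J \<subseteq> R" "J \<noteq> {}"
    and f: "\<And>xs. xs \<in> nlists m J \<Longrightarrow> f xs \<subseteq> J"
    and neg: "\<And>a. a \<in> J \<Longrightarrow> neg a \<in> J"
    and mul: "\<And>a r. a \<in> J \<Longrightarrow> r \<in> R \<Longrightarrow> a \<cdot> r \<in> J"
  shows "hyperideal m n R f g J"
  unfolding hyperideal_def
proof (intro conjI ballI allI impI)
  fix bs b i
  assume bs: "bs \<in> nlists (m - 1) J" and b: "b \<in> J" and i: "i < m"
  then have "bs \<in> nlists (m - 1) R"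
    using assms(1) by (auto simp: nlists_iff)
  with f_solvable[of bs b i] b i assms(1)
  obtain x where x: "x \<in> R" "b \<in> f (insert_at i x bs)"
    by blast
  have "insert_at i x bs \<in> nlists m R"
    using bs x(1) m_ge_2 assms(1) by (auto simp: nlists_iff length_insert_at set_insert_at)
  from reversible[OF this x(2) i] have "x \<in> f (b # map neg bs)"
    using bs i by (simp add: nth_insert_at remove_at_insert_at nlists_iff)
  moreover have "b # map neg bs \<in> nlists m J"
    using bs b m_ge_2 by (auto simp: nlists_iff neg)
  ultimately show "\<exists>x\<in>J. b \<in> f (insert_at i x bs)"
    using f x(2) by blast
next
  fix as a i
  assume as: "as \<in> nlists (n - 1) R" and a: "a \<in> J" and "i < n"
  have mem: "insert_at i a as \<in> nlists n R"
    using as a assms(1) n_ge_2 by (auto simp: nlists_iff length_insert_at set_insert_at)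
  have mem': "a # as \<in> nlists n R"
    using as a assms(1) n_ge_2 by (auto simp: nlists_iff)
  have "g (insert_at i a as) = g (a # as)"
    using mem by (intro g_perm) (simp_all add: mset_insert_at)
  also have "\<dots> = a \<cdot> lprod as"
    using mem' by (simp add: g_eq_lprod)
  finally show "g (insert_at i a as) \<in> J"
    using mul[OF a lprod_closed] as by (simp add: nlists_iff)
qed (use assms in auto)

lemma hyperideal_subset: "hyperideal m n R f g J \<Longrightarrow> J \<subseteq> R"
  by (simp add: hyperideal_def)

lemma hyperideal_solvable:
  "hyperideal m n R f g J \<Longrightarrow> bs \<in> nlists (m - 1) J \<Longrightarrow> b \<in> J \<Longrightarrow> i < m \<Longrightarrow>
    \<exists>x\<in>J. b \<in> f (insert_at i x bs)"
  by (simp add: hyperideal_def)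

lemma hyperideal_absorb:
  "hyperideal m n R f g J \<Longrightarrow> as \<in> nlists (n - 1) R \<Longrightarrow> a \<in> J \<Longrightarrow> i < n \<Longrightarrow>
    g (insert_at i a as) \<in> J"
  by (simp add: hyperideal_def)

lemma hyperideal_mul:
  assumes "hyperideal m n R f g J" "a \<in> J" "r \<in> R"
  shows "a \<cdot> r \<in> J"
proof -
  have "r # replicate (n - 2) e \<in> nlists (n - 1) R"
    using assms n_ge_2 e_in by (auto simp: nlists_iff)
  then have "g (insert_at 0 a (r # replicate (n - 2) e)) \<in> J"
    using assms n_ge_2 by (intro hyperideal_absorb) auto
  then show ?thesis
    by (simp add: insert_at_def mul_def)
qed

lemma hyperideal_zero:
  assumes "hyperideal m n R f g J"
  shows "zero \<in> J"
proof -
  obtain a where a: "a \<in> J" "a \<in> R"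
    using assms unfolding hyperideal_def by blast
  then have "a \<cdot> zero = zero"
    using mul_comm[of a zero] zero_in by (simp add: zero_mul)
  then show ?thesis
    using hyperideal_mul[OF assms a(1) zero_in] by simp
qed

text \<open>Solving for zero inside \<open>J\<close>, with \<open>a\<close> and zeros as the other
  arguments, yields a negative of \<open>a\<close>, which uniqueness identifies with
  \<open>neg a\<close>.\<close>

lemma hyperideal_neg:
  assumes "hyperideal m n R f g J" "a \<in> J"
  shows "neg a \<in> J"
proof -
  let ?bs = "a # replicate (m - 2) zero"
  note z = hyperideal_zero[OF assms(1)]
  have "?bs \<in> nlists (m - 1) J"
    using assms(2) z m_ge_2 by (auto simp: nlists_iff)
  then obtain x where x: "x \<in> J" "zero \<in> f (insert_at 1 x ?bs)"
    using hyperideal_solvable[OF assms(1) _ z, of ?bs 1] m_ge_2 by auto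
  have "x = neg a"
    using x assms(2) hyperideal_subset[OF assms(1)] by (intro neg_unique) (auto simp: insert_at_def)
  then show ?thesis
    using x(1) by simp
qed

section \<open>Colon and principal hyperideals\<close>

lemma mem_colon: "r \<in> colon n R g e I s \<longleftrightarrow> r \<in> R \<and> r \<cdot> s \<in> I"
  by (simp add: colon_def mul_def)

lemma hyperideal_subset_colon:
  "hyperideal m n R f g I \<Longrightarrow> s \<in> R \<Longrightarrow> I \<subseteq> colon n R g e I s"
  by (simp add: subset_iff mem_colon hyperideal_mul hyperideal_subset[THEN subsetD])

text \<open>The colon is the preimage of \<open>I\<close> under multiplication by \<open>s\<close>,
  which respects \<open>f\<close> and negatives.\<close>

lemma hyperideal_colon:
  assumes I: "hyperideal m n R f g I" and s: "s \<in> R"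
  shows "hyperideal m n R f g (colon n R g e I s)"
proof (rule hyperidealI)
  show "colon n R g e I s \<noteq> {}"
    using hyperideal_subset_colon[OF I s] hyperideal_zero[OF I] by blast
next
  fix xs
  assume xs: "xs \<in> nlists m (colon n R g e I s)"
  then have xs': "xs \<in> nlists m R"
    by (auto simp: nlists_iff mem_colon)
  have "map (\<lambda>x. x \<cdot> s) xs \<in> nlists m I"
    using xs by (auto simp: nlists_iff mem_colon)
  then have "f (map (\<lambda>x. x \<cdot> s) xs) \<subseteq> I"
    using I by (simp add: hyperideal_def)
  then have "(\<lambda>x. x \<cdot> s) ` f xs \<subseteq> I"
    by (simp only: f_distrib[OF xs' s])
  then show "f xs \<subseteq> colon n R g e I s"
    using f_closed[OF xs'] unfolding subset_iff mem_colon by blast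
next
  fix a
  assume "a \<in> colon n R g e I s"
  then show "neg a \<in> colon n R g e I s"
    using s hyperideal_neg[OF I] by (auto simp: mem_colon neg_mul neg_in)
next
  fix a r
  assume "a \<in> colon n R g e I s" "r \<in> R"
  moreover from this have "a \<cdot> r \<cdot> s = a \<cdot> s \<cdot> r"
    using s by (simp add: mem_colon mul_ac mul_closed)
  ultimately show "a \<cdot> r \<in> colon n R g e I s"
    using hyperideal_mul[OF I] by (simp add: mem_colon mul_closed)
qed (auto simp: mem_colon)

lemma hyperideal_principal:
  assumes x: "x \<in> R"
  shows "hyperideal m n R f g ((\<lambda>r. r \<cdot> x) ` R)"
proof (rule hyperidealI)
  fix ys
  assume ys: "ys \<in> nlists m ((\<lambda>r. r \<cdot> x) ` R)"
  then have "ys \<in> lists ((\<lambda>r. r \<cdot> x) ` R)"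
    by (auto simp: nlists_iff)
  \<comment> \<open>Coefficients for all entries are chosen at once, so that distributivity over
    \<open>rs\<close> turns the sum into multiples of \<open>x\<close>.\<close>
  then have "ys \<in> map (\<lambda>r. r \<cdot> x) ` lists R"
    by (simp only: lists_image)
  then obtain rs where rs: "set rs \<subseteq> R" "ys = map (\<lambda>r. r \<cdot> x) rs"
    by (auto simp: lists_eq_set)
  then have rs': "rs \<in> nlists m R"
    using ys by (simp add: nlists_iff)
  show "f ys \<subseteq> (\<lambda>r. r \<cdot> x) ` R"
    using f_distrib[OF rs' x] f_closed[OF rs'] rs(2) by auto
next
  fix a r
  assume "a \<in> (\<lambda>r. r \<cdot> x) ` R" and r: "r \<in> R"
  then obtain t where t: "t \<in> R" "a = t \<cdot> x"
    by blast
  then have "a \<cdot> r = t \<cdot> r \<cdot> x"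
    using r x by (simp add: mul_ac mul_closed)
  then show "a \<cdot> r \<in> (\<lambda>r. r \<cdot> x) ` R"
    using t r mul_closed by blast
next
  fix a
  assume "a \<in> (\<lambda>r. r \<cdot> x) ` R"
  then obtain t where "t \<in> R" "a = t \<cdot> x"
    by blast
  then show "neg a \<in> (\<lambda>r. r \<cdot> x) ` R"
    using neg_mul[of t x] x neg_in[of t] by force
qed (use x e_in in \<open>auto simp: mul_closed\<close>)

text \<open>By commutativity the coefficients gather into \<open>r\<close>; so a product taken from
  principal hyperideals is a multiple of the product of their generators.\<close>

lemma lprod_mem_mul_lprod:
  assumes "list_all2 (\<lambda>y x. y \<in> (\<lambda>r. r \<cdot> x) ` R) ys xs" "set xs \<subseteq> R"
  shows "\<exists>r\<in>R. lprod ys = lprod xs \<cdot> r"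
  using assms
proof (induction rule: list_all2_induct)
  case Nil
  show ?case
    using e_in mul_e[OF e_in] by (intro bexI[of _ e]) simp_all
next
  case (Cons y ys x xs)
  then obtain r t where r: "r \<in> R" "lprod ys = lprod xs \<cdot> r" and t: "t \<in> R" "y = t \<cdot> x"
    by auto
  have "lprod xs \<in> R" "x \<in> R"
    using Cons.prems lprod_closed by auto
  then have "lprod (y # ys) = lprod (x # xs) \<cdot> (t \<cdot> r)"
    using r t by (simp add: mul_ac mul_closed)
  then show ?case
    using r t mul_closed by blast
qed

section \<open>Elementwise primeness\<close>

text \<open>Principal hyperideals transfer the condition on hyperideals to their generators.
  Conversely, if no \<open>Us ! i\<close> lies in \<open>P\<close>, elements chosen outside
  \<open>P\<close> have their product in \<open>P\<close>, against the elementwise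
  condition.\<close>

lemma prime_hyperideal_iff:
  assumes P: "hyperideal m n R f g P"
  shows "prime_hyperideal m n R f g P \<longleftrightarrow>
    P \<noteq> R \<and> (\<forall>xs\<in>nlists n R. g xs \<in> P \<longrightarrow> (\<exists>i<n. xs ! i \<in> P))"
proof (intro iffI conjI ballI impI)
  fix xs
  assume prime: "prime_hyperideal m n R f g P" and xs: "xs \<in> nlists n R" and g: "g xs \<in> P"
  let ?Us = "map (\<lambda>x. (\<lambda>r. r \<cdot> x) ` R) xs"
  have Us: "?Us \<in> nlists n {U. hyperideal m n R f g U}"
    using xs hyperideal_principal by (auto simp: nlists_iff)
  have "g ys \<in> P" if "ys \<in> listset ?Us" for ys
  proof -
    have l: "list_all2 (\<lambda>y x. y \<in> (\<lambda>r. r \<cdot> x) ` R) ys xs"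
      using that by (simp add: mem_listset_iff list.rel_map)
    then have "set ys \<subseteq> R" if "set xs \<subseteq> R"
      using that by (induction rule: list_all2_induct) (auto intro: mul_closed)
    then have "ys \<in> nlists n R"
      using xs list_all2_lengthD[OF l] by (simp add: nlists_iff)
    then show ?thesis
      using lprod_mem_mul_lprod[OF l] xs g hyperideal_mul[OF P]
      by (auto simp: g_eq_lprod nlists_iff)
  qed
  then have "g ` listset ?Us \<subseteq> P"
    by blast
  then obtain i where i: "i < n" "?Us ! i \<subseteq> P"
    using prime Us unfolding prime_hyperideal_def by blast
  moreover have "xs ! i \<in> R" "length xs = n"
    using xs i by (auto simp: nlists_iff)
  \<comment> \<open>The identity puts each generator into its own principal hyperideal.\<close>
  ultimately have "e \<cdot> xs ! i \<in> P" "xs ! i \<in> R"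
    using e_in by auto
  then show "\<exists>i<n. xs ! i \<in> P"
    using i e_mul by auto
next
  assume *: "P \<noteq> R \<and> (\<forall>xs\<in>nlists n R. g xs \<in> P \<longrightarrow> (\<exists>i<n. xs ! i \<in> P))"
  have "\<exists>i<n. Us ! i \<subseteq> P"
    if Us: "Us \<in> nlists n {U. hyperideal m n R f g U}" and sub: "g ` listset Us \<subseteq> P" for Us
  proof (rule ccontr)
    assume "\<not> (\<exists>i<n. Us ! i \<subseteq> P)"
    then have "\<forall>i. \<exists>x. i < n \<longrightarrow> x \<in> Us ! i \<and> x \<notin> P"
      by blast
    then obtain u where u: "\<And>i. i < n \<Longrightarrow> u i \<in> Us ! i \<and> u i \<notin> P"
      by metis
    let ?us = "map u [0..<n]"
    have "?us \<in> listset Us"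
      using u Us by (simp add: mem_listset_iff list_all2_conv_all_nth nlists_iff)
    then have "g ?us \<in> P"
      using sub by blast
    moreover have "u i \<in> R" if "i < n" for i
    proof -
      have "Us ! i \<in> {U. hyperideal m n R f g U}"
        using Us that by (rule nlistsE_nth_in)
      then show ?thesis
        using u[OF that] hyperideal_subset by blast
    qed
    then have "?us \<in> nlists n R"
      by (auto simp: nlists_iff)
    ultimately obtain i where "i < n" "?us ! i \<in> P"
      using * by blast
    then show False
      using u by simp
  qed
  then show "prime_hyperideal m n R f g P"
    using P * by (simp add: prime_hyperideal_def)
qed (simp add: prime_hyperideal_def)

section \<open>S-primeness and the colon\<close>

text \<open>
  An \<open>n\<close>-ary multiplicative set need not contain the cube of its elements: only exponents congruent
  to 1 modulo \<open>n - 1\<close> are available.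
\<close>

lemma cube_not_in_hyperideal:
  assumes I: "hyperideal m n R f g I" and S: "multiplicative_subset n R g S"
    and "I \<inter> S = {}" and s: "s \<in> S"
  shows "s \<cdot> (s \<cdot> s) \<notin> I"
proof
  assume cube: "s \<cdot> (s \<cdot> s) \<in> I"
  have SR: "S \<subseteq> R" and closed: "\<And>xs. xs \<in> nlists n S \<Longrightarrow> g xs \<in> S"
    using S by (auto simp: multiplicative_subset_def)
  have sR: "s \<in> R"
    using s SR by blast
  \<comment> \<open>\<open>?p\<close> is the power of \<open>s\<close> with exponent n - 2, so
    multiplying an element of \<open>S\<close> by \<open>s \<cdot> ?p\<close> is a single
    \<open>n\<close>-ary product in \<open>S\<close>.\<close>
  let ?p = "lprod (replicate (n - 2) s)"
  have p: "?p \<in> R"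
    using sR by (intro lprod_closed) auto
  have step: "t \<cdot> (s \<cdot> ?p) \<in> S" if t: "t \<in> S" for t
  proof -
    have "t # replicate (n - 1) s \<in> nlists n S"
      using s t n_ge_2 by (auto simp: nlists_iff)
    then have "g (t # replicate (n - 1) s) \<in> S"
      by (rule closed)
    moreover have "t # replicate (n - 1) s \<in> nlists n R"
      using s t SR n_ge_2 by (auto simp: nlists_iff)
    then have "g (t # replicate (n - 1) s) = t \<cdot> (s \<cdot> ?p)"
      unfolding replicate_n_minus_1 by (simp add: g_eq_lprod)
    ultimately show ?thesis
      by (simp only:)
  qed
  \<comment> \<open>Two steps from \<open>s\<close> reach the exponent 2n - 1 = 3 + 2(n - 2), a
    multiple of the cube.\<close>
  have "s \<cdot> (s \<cdot> ?p) \<cdot> (s \<cdot> ?p) \<in> S"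
    using s by (intro step)
  moreover have "s \<cdot> (s \<cdot> ?p) \<cdot> (s \<cdot> ?p) = s \<cdot> (s \<cdot> s) \<cdot> (?p \<cdot> ?p)"
    using sR p by (simp add: mul_ac mul_closed)
  moreover have "s \<cdot> (s \<cdot> s) \<cdot> (?p \<cdot> ?p) \<in> I"
    using hyperideal_mul[OF I cube] p mul_closed by blast
  ultimately show False
    using assms(3) by auto
qed

lemma S_prime_imp_colon_elementwise_prime:
  assumes I: "hyperideal m n R f g I" and S: "multiplicative_subset n R g S"
    and disj: "I \<inter> S = {}" and s: "s \<in> S"
    and S_prime: "\<And>xs. xs \<in> nlists n R \<Longrightarrow> g xs \<in> I \<Longrightarrow> \<exists>i<n. s \<cdot> xs ! i \<in> I"
    and xs: "xs \<in> nlists n R" and g: "g xs \<in> colon n R g e I s"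
  shows "\<exists>i<n. xs ! i \<in> colon n R g e I s"
proof -
  have sR: "s \<in> R"
    using s S by (auto simp: multiplicative_subset_def)
  have mem: "xs ! i \<in> colon n R g e I s" if "i < n" "s \<cdot> xs ! i \<in> I" for i
  proof -
    have "xs ! i \<in> R"
      using that xs by (auto simp: nlists_iff)
    then show ?thesis
      using that sR mul_comm[of s "xs ! i"] by (simp add: mem_colon)
  qed
  obtain y ys where xs_eq: "xs = y # ys"
    using xs n_ge_2 by (cases xs) (auto simp: nlists_iff)
  have yR: "y \<in> R" and ysR: "set ys \<subseteq> R"
    using xs by (auto simp: xs_eq nlists_iff)
  \<comment> \<open>The factor \<open>s\<close> supplied by membership in the colon is absorbed into
    the first argument, which keeps the arity.\<close>
  have sy: "s \<cdot> y # ys \<in> nlists n R"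
    using xs sR by (auto simp: xs_eq nlists_iff mul_closed)
  have "g (s \<cdot> y # ys) = g xs \<cdot> s"
    using xs sy sR yR lprod_closed[OF ysR]
    by (simp add: xs_eq g_eq_lprod mul_ac mul_closed)
  then have "g (s \<cdot> y # ys) \<in> I"
    using g by (simp add: mem_colon)
  then obtain i where i: "i < n" "s \<cdot> (s \<cdot> y # ys) ! i \<in> I"
    using S_prime[OF sy] by blast
  show ?thesis
  proof (cases i)
    \<comment> \<open>Only the head was changed, so entry \<open>i\<close> is still that of
      \<open>xs\<close>.\<close>
    case (Suc j)
    then show ?thesis
      using i mem[of i] by (auto simp: xs_eq)
  next
    case 0
    let ?zs = "s \<cdot> s # y # replicate (n - 2) e"
    have zs: "?zs \<in> nlists n R"
      using sR yR e_in n_ge_2 by (auto simp: nlists_iff mul_closed)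
    have "g ?zs = s \<cdot> (s \<cdot> y)"
      using sR yR by (simp add: mul_assoc flip: mul_def)
    then have "g ?zs \<in> I"
      using 0 i by simp
    then obtain j where j: "j < n" "s \<cdot> ?zs ! j \<in> I"
      using S_prime[OF zs] by blast
    have "j \<noteq> 0"
      using j cube_not_in_hyperideal[OF I S disj s] by (cases j) auto
    \<comment> \<open>From position 2 on all entries are \<open>e\<close>, and such a
      \<open>j\<close> would put \<open>s\<close> itself into \<open>I\<close>.\<close>
    moreover have "j \<noteq> Suc (Suc k)" for k
      using j disj s sR by (auto simp: mul_e)
    ultimately have "j = 1"
      by (metis One_nat_def not0_implies_Suc)
    then show ?thesis
      using j mem[of 0] by (intro exI[of _ 0]) (simp add: xs_eq)
  qed
qed

text \<open>The witness does not change: the two conditions are equivalent for each single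
  \<open>s\<close>.\<close>

lemma S_prime_hyperideal_iff_colon_prime:
  assumes I: "hyperideal m n R f g I" and S: "multiplicative_subset n R g S"
    and disj: "I \<inter> S = {}"
  shows "S_prime_hyperideal m n R f g e S I \<longleftrightarrow>
    (\<exists>s\<in>S. prime_hyperideal m n R f g (colon n R g e I s))"
proof -
  have "(\<forall>xs\<in>nlists n R. g xs \<in> I \<longrightarrow> (\<exists>i<n. s \<cdot> xs ! i \<in> I)) \<longleftrightarrow>
    prime_hyperideal m n R f g (colon n R g e I s)" if s: "s \<in> S" for s
  proof
    have sR: "s \<in> R"
      using s S by (auto simp: multiplicative_subset_def)
    note prime_iff = prime_hyperideal_iff[OF hyperideal_colon[OF I sR]]
    \<comment> \<open>Properness: \<open>e \<cdot> s = s\<close> lies in \<open>S\<close>, hence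
      outside \<open>I\<close>.\<close>
    have "e \<notin> colon n R g e I s"
      using s disj sR by (auto simp: mem_colon e_mul)
    then have "colon n R g e I s \<noteq> R"
      using e_in by blast
    then show "prime_hyperideal m n R f g (colon n R g e I s)"
      if "\<forall>xs\<in>nlists n R. g xs \<in> I \<longrightarrow> (\<exists>i<n. s \<cdot> xs ! i \<in> I)"
      using that S_prime_imp_colon_elementwise_prime[OF I S disj s] by (simp add: prime_iff)
    show "\<forall>xs\<in>nlists n R. g xs \<in> I \<longrightarrow> (\<exists>i<n. s \<cdot> xs ! i \<in> I)"
      if prime: "prime_hyperideal m n R f g (colon n R g e I s)"
    proof (intro ballI impI)
      fix xs
      assume "xs \<in> nlists n R" "g xs \<in> I"
      then obtain i where "i < n" "xs ! i \<in> colon n R g e I s"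
        using prime hyperideal_subset_colon[OF I sR] unfolding prime_iff by blast
      then show "\<exists>i<n. s \<cdot> xs ! i \<in> I"
        using sR mul_comm[of s "xs ! i"] by (auto simp: mem_colon)
    qed
  qed
  then show ?thesis
    using I disj by (auto simp: S_prime_hyperideal_def simp flip: mul_def)
qed

end

theorem theorem3p4:
  fixes m n :: nat and R S I :: "'a set"
    and f :: "'a list \<Rightarrow> 'a set" and g :: "'a list \<Rightarrow> 'a" and e :: 'a
  assumes "comm_krasner_hyperring m n R f g"
    and "scalar_identity n R g e"
    and "multiplicative_subset n R g S"
    and "hyperideal m n R f g I"
    and "I \<inter> S = {}"
  shows "S_prime_hyperideal m n R f g e S I \<longleftrightarrow>
    (\<exists>s\<in>S. prime_hyperideal m n R f g (colon n R g e I s))"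
proof -
  interpret comm_krasner_hyperring m n R f g
    by (rule assms(1))
  interpret unital_krasner_hyperring m n R f g e
    by unfold_locales (rule assms(2))
  show ?thesis
    using S_prime_hyperideal_iff_colon_prime assms(3-5) by blast
qed

end
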